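(* Let $\Gamma\to\operatorname{U}(V)$ be a unitary representation of a finite group $\Gamma$ on a finite-dimensional hermitean vector space $V$. Then any $X\in\operatorname{Der}(\mathcal C^\infty(V))$ such that $X|_{\mathcal C^\infty(V)^\Gamma}=0$ vanishes.
   Context: $\mathcal C^\infty(V)$ is the algebra of smooth real-valued functions on $V$ viewed as a real vector space, $\mathcal C^\infty(V)^\Gamma$ its subalgebra of $\Gamma$-invariant functions, and $\operatorname{Der}(\mathcal C^\infty(V))$ the module of $\mathbb R$-linear derivations (smooth vector fields). *)

theory Defs
  imports "HOL-Analysis.Analysis" "HOL-Algebra.Group"
begin

text \<open>Standard hermitean inner product on complex^'n (linear in the first argument).\<close>
definition herm_inner :: "complex^'n \<Rightarrow> complex^'n \<Rightarrow> complex" where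
  "herm_inner x y = (\<Sum>i\<in>UNIV. x $ i * cnj (y $ i))"

text \<open>Unitary operators: complex-linear bijections preserving the hermitean product.\<close>
definition unitary_map :: "(complex^'n \<Rightarrow> complex^'n) \<Rightarrow> bool" where
  "unitary_map U \<longleftrightarrow> Vector_Spaces.linear (*s) (*s) U \<and> bij U \<and>
     (\<forall>x y. herm_inner (U x) (U y) = herm_inner x y)"

text \<open>C^k real-valued functions on a real normed vector space (finite-dimensional in use).\<close>
fun Ck :: "nat \<Rightarrow> ('a::real_normed_vector \<Rightarrow> real) \<Rightarrow> bool" where
  "Ck 0 f = continuous_on UNIV f"
| "Ck (Suc k) f = ((\<forall>x. f differentiable (at x)) \<and>
                    (\<forall>v. Ck k (\<lambda>x. frechet_derivative f (at x) v)))"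

definition smooth :: "('a::real_normed_vector \<Rightarrow> real) \<Rightarrow> bool" where
  "smooth f \<longleftrightarrow> (\<forall>k. Ck k f)"

text \<open>R-linear derivations of the algebra C^\<infinity>(V) (values off C^\<infinity>(V) are irrelevant).\<close>
definition smooth_derivation :: "(('a::real_normed_vector \<Rightarrow> real) \<Rightarrow> ('a \<Rightarrow> real)) \<Rightarrow> bool" where
  "smooth_derivation X \<longleftrightarrow>
     (\<forall>f. smooth f \<longrightarrow> smooth (X f)) \<and>
     (\<forall>f g. smooth f \<longrightarrow> smooth g \<longrightarrow> X (\<lambda>x. f x + g x) = (\<lambda>x. X f x + X g x)) \<and>
     (\<forall>c f. smooth f \<longrightarrow> X (\<lambda>x. c * f x) = (\<lambda>x. c * X f x)) \<and>
     (\<forall>f g. smooth f \<longrightarrow> smooth g \<longrightarrow> X (\<lambda>x. f x * g x) = (\<lambda>x. f x * X g x + X f x * g x))"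

end

theory Submission
  imports Defs "HOL-Computational_Algebra.Polynomial"
begin

text \<open>
  Let \<open>S = \<rho>(\<Gamma>)\<close>, a finite group of linear maps. For a smooth \<open>F\<close>, the
  coefficients of the orbit polynomial \<open>P\<^sub>y(T) = \<Prod>\<^sub>s\<^sub>\<in>\<^sub>S (T - F(s y))\<close> are smooth and invariant,
  so \<open>X\<close> kills them; applying \<open>X\<close> to the identity \<open>P\<^sub>y(F y) = 0\<close> gives
  \<open>P\<^sub>y'(F y) \<cdot> (X F)(y) = 0\<close>. If the values \<open>F(s x)\<close>, \<open>s \<noteq> id\<close>, all differ from \<open>F x\<close>, then
  \<open>P\<^sub>x'(F x) \<noteq> 0\<close> and hence \<open>(X F)(x) = 0\<close>. At a point \<open>x\<close> with trivial stabiliser every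
  smooth \<open>f\<close> is a difference of two such functions, \<open>f + t |y - x|\<^sup>2\<close> and \<open>t |y - x|\<^sup>2\<close>, for a
  suitable real \<open>t\<close>. These points form the complement of finitely many proper linear
  subspaces, which is dense, so the continuous function \<open>X f\<close> vanishes everywhere.
\<close>

lemma Ck_const: "Ck k (\<lambda>x::'a::real_normed_vector. c)"
proof (induction k arbitrary: c)
  case (Suc k)
  have "frechet_derivative (\<lambda>x::'a. c) (at x) = (\<lambda>v. 0)" for x
    by (metis frechet_derivative_at has_derivative_const)
  then show ?case using Suc by simp
qed simp

lemma Ck_SucD: "Ck (Suc k) f \<Longrightarrow> Ck k f"
proof (induction k arbitrary: f)
  case 0
  then show ?case
    by (auto intro!: continuous_at_imp_continuous_on differentiable_imp_continuous_within)
qed simp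

lemma Ck_add: "Ck k f \<Longrightarrow> Ck k g \<Longrightarrow> Ck k (\<lambda>x. f x + g x)"
proof (induction k arbitrary: f g)
  case 0 then show ?case by (simp add: continuous_on_add)
next
  case (Suc k)
  have "frechet_derivative (\<lambda>x. f x + g x) (at x) =
          (\<lambda>v. frechet_derivative f (at x) v + frechet_derivative g (at x) v)" for x
    using Suc.prems
    by (intro frechet_derivative_at[symmetric] has_derivative_add)
       (auto simp: frechet_derivative_works)
  then show ?case using Suc by simp
qed

lemma Ck_mult: "Ck k f \<Longrightarrow> Ck k g \<Longrightarrow> Ck k (\<lambda>x. f x * g x)"
proof (induction k arbitrary: f g)
  case 0 then show ?case by (simp add: continuous_on_mult)
next
  case (Suc k)
  have "frechet_derivative (\<lambda>x. f x * g x) (at x) =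
          (\<lambda>v. f x * frechet_derivative g (at x) v + frechet_derivative f (at x) v * g x)" for x
    using Suc.prems
    by (intro frechet_derivative_at[symmetric] has_derivative_mult)
       (auto simp: frechet_derivative_works)
  moreover have "Ck k f" "Ck k g" using Suc.prems Ck_SucD by blast+
  ultimately show ?case using Suc by (simp add: Ck_add)
qed

lemma Ck_bounded_linear:
  assumes l: "bounded_linear l"
  shows "Ck k l"
proof (cases k)
  case 0
  then show ?thesis using l by (simp add: linear_continuous_on)
next
  case (Suc m)
  have "frechet_derivative l (at x) = l" for x
    using bounded_linear_imp_has_derivative[OF l] by (rule frechet_derivative_at[symmetric])
  then show ?thesis using Suc l Ck_const by (auto simp: bounded_linear_imp_differentiable)
qed

lemma Ck_compose_bounded_linear: "bounded_linear L \<Longrightarrow> Ck k f \<Longrightarrow> Ck k (\<lambda>x. f (L x))"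
proof (induction k arbitrary: f)
  case 0 then show ?case
    by (simp add: continuous_on_compose2[OF _ linear_continuous_on])
next
  case (Suc k)
  have f: "(f has_derivative frechet_derivative f (at y)) (at y)" for y
    using Suc.prems by (auto simp: frechet_derivative_works)
  have "((\<lambda>x. f (L x)) has_derivative (\<lambda>v. frechet_derivative f (at (L x)) (L v))) (at x)" for x
    using diff_chain_at[OF bounded_linear_imp_has_derivative[OF Suc.prems(1)] f]
    by (simp add: o_def)
  then have "(\<lambda>x. f (L x)) differentiable (at x)"
    and "frechet_derivative (\<lambda>x. f (L x)) (at x) = (\<lambda>v. frechet_derivative f (at (L x)) (L v))" for x
    by (auto simp: differentiable_def intro: frechet_derivative_at[symmetric])
  moreover have "Ck k (\<lambda>x. frechet_derivative f (at (L x)) (L v))" for v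
    using Suc.IH[of "\<lambda>y. frechet_derivative f (at y) (L v)"] Suc.prems by auto
  ultimately show ?case by simp
qed

lemma smooth_const: "smooth (\<lambda>x. c)"
  by (simp add: smooth_def Ck_const)

lemma smooth_add: "smooth f \<Longrightarrow> smooth g \<Longrightarrow> smooth (\<lambda>x. f x + g x)"
  by (simp add: smooth_def Ck_add)

lemma smooth_mult: "smooth f \<Longrightarrow> smooth g \<Longrightarrow> smooth (\<lambda>x. f x * g x)"
  by (simp add: smooth_def Ck_mult)

lemma smooth_minus: "smooth f \<Longrightarrow> smooth (\<lambda>x. - f x)"
  using smooth_mult[OF smooth_const[of "-1"]] by simp

lemma smooth_bounded_linear: "bounded_linear l \<Longrightarrow> smooth l"
  by (simp add: smooth_def Ck_bounded_linear)

lemma smooth_compose_bounded_linear: "bounded_linear L \<Longrightarrow> smooth f \<Longrightarrow> smooth (\<lambda>x. f (L x))"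
  by (simp add: smooth_def Ck_compose_bounded_linear)

lemma smooth_power: "smooth f \<Longrightarrow> smooth (\<lambda>x. f x ^ k)"
  by (induction k) (auto intro: smooth_mult smooth_const)

lemma smooth_sum: "finite K \<Longrightarrow> (\<And>k. k \<in> K \<Longrightarrow> smooth (h k)) \<Longrightarrow> smooth (\<lambda>x. \<Sum>k\<in>K. h k x)"
  by (induction K rule: finite_induct) (auto intro: smooth_add smooth_const)

lemma smooth_imp_continuous_on: "smooth f \<Longrightarrow> continuous_on UNIV f"
  by (metis smooth_def Ck.simps(1))

lemma smooth_norm_diff_power2:
  fixes x :: "'a::euclidean_space"
  shows "smooth (\<lambda>y. (norm (y - x))\<^sup>2)"
proof -
  have "(norm (y - x))\<^sup>2 = (\<Sum>b\<in>Basis. ((y \<bullet> b) + - (x \<bullet> b))\<^sup>2)" for y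
  proof -
    have "(norm (y - x))\<^sup>2 = (\<Sum>b\<in>Basis. ((y - x) \<bullet> b) * ((y - x) \<bullet> b))"
      unfolding power2_norm_eq_inner by (rule euclidean_inner)
    then show ?thesis by (simp add: power2_eq_square inner_diff_left)
  qed
  moreover have "smooth (\<lambda>y. (y \<bullet> b) + - (x \<bullet> b))" for b :: 'a
    by (rule smooth_add[OF smooth_bounded_linear[OF bounded_linear_inner_left] smooth_const])
  ultimately show ?thesis
    by (simp only:) (rule smooth_sum[OF finite_Basis smooth_power])
qed

lemma smooth_coeff_prod_linear_factors:
  assumes "finite A" "\<And>s. s \<in> A \<Longrightarrow> smooth (a s)"
  shows "smooth (\<lambda>y. coeff (\<Prod>s\<in>A. [:- a s y, 1:]) k)"
  using assms
proof (induction A arbitrary: k rule: finite_induct)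
  case empty
  show ?case by (simp add: smooth_const)
next
  case (insert s A)
  have coeff_insert: "coeff (\<Prod>s\<in>insert s A. [:- a s y, 1:]) k =
     - a s y * coeff (\<Prod>s\<in>A. [:- a s y, 1:]) k +
     (if k = 0 then 0 else coeff (\<Prod>s\<in>A. [:- a s y, 1:]) (k - 1))" for y
    using insert by (simp add: coeff_pCons')
  have "smooth (\<lambda>y. - a s y * coeff (\<Prod>s\<in>A. [:- a s y, 1:]) k)"
    using insert by (simp add: smooth_mult smooth_minus)
  moreover have "smooth (\<lambda>y. if k = 0 then 0 else coeff (\<Prod>s\<in>A. [:- a s y, 1:]) (k - 1))"
    using insert by (cases "k = 0") (simp_all add: smooth_const)
  ultimately show ?case
    unfolding coeff_insert by (rule smooth_add)
qed

lemma poly_eq_sum_coeff_le: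
  fixes p :: "'a::comm_semiring_1 poly"
  assumes "degree p \<le> n"
  shows "poly p x = (\<Sum>i\<le>n. coeff p i * x ^ i)"
proof -
  have "poly p x = poly (\<Sum>i\<le>n. monom (coeff p i) i) x"
    by (simp only: poly_as_sum_of_monoms'[OF assms])
  then show ?thesis by (simp add: poly_sum poly_monom)
qed

lemma poly_pderiv_eq_sum_coeff_le:
  fixes p :: "real poly"
  assumes "degree p \<le> n"
  shows "poly (pderiv p) x = (\<Sum>i\<le>n. coeff p i * (of_nat i * x ^ (i - 1)))"
proof -
  have "((\<lambda>t. \<Sum>i\<le>n. coeff p i * t ^ i) has_real_derivative
          (\<Sum>i\<le>n. coeff p i * (of_nat i * x ^ (i - 1)))) (at x)"
    by (auto intro!: derivative_eq_intros sum.cong simp: mult_ac)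
  moreover have "(\<lambda>t. \<Sum>i\<le>n. coeff p i * t ^ i) = poly p"
    using poly_eq_sum_coeff_le[OF assms] by auto
  ultimately show ?thesis
    using poly_DERIV DERIV_unique by metis
qed

context
  fixes X :: "('a::real_normed_vector \<Rightarrow> real) \<Rightarrow> ('a \<Rightarrow> real)"
  assumes X: "smooth_derivation X"
begin

lemma derivation_add: "smooth f \<Longrightarrow> smooth g \<Longrightarrow> X (\<lambda>x. f x + g x) = (\<lambda>x. X f x + X g x)"
  using X by (simp add: smooth_derivation_def)

lemma derivation_scale: "smooth f \<Longrightarrow> X (\<lambda>x. c * f x) = (\<lambda>x. c * X f x)"
  using X by (simp add: smooth_derivation_def)

lemma derivation_mult:
  "smooth f \<Longrightarrow> smooth g \<Longrightarrow> X (\<lambda>x. f x * g x) = (\<lambda>x. f x * X g x + X f x * g x)"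
  using X by (simp add: smooth_derivation_def)

lemma derivation_smooth: "smooth f \<Longrightarrow> smooth (X f)"
  using X by (simp add: smooth_derivation_def)

lemma derivation_const: "X (\<lambda>x. c) = (\<lambda>x. 0)"
proof -
  have "X (\<lambda>x. 1) = (\<lambda>x. X (\<lambda>x. 1) x + X (\<lambda>x. 1) x)"
    using derivation_mult[OF smooth_const smooth_const, of 1 1] by simp
  then have "X (\<lambda>x. 1) = (\<lambda>x. 0)"
    by (metis add_cancel_left_right)
  then show ?thesis
    using derivation_scale[OF smooth_const, of c 1] by simp
qed

lemma derivation_sum:
  "finite K \<Longrightarrow> (\<And>k. k \<in> K \<Longrightarrow> smooth (h k)) \<Longrightarrow>
     X (\<lambda>x. \<Sum>k\<in>K. h k x) = (\<lambda>x. \<Sum>k\<in>K. X (h k) x)"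
  by (induction K rule: finite_induct) (simp_all add: derivation_const derivation_add smooth_sum)

lemma derivation_power: "smooth f \<Longrightarrow> X (\<lambda>x. f x ^ k) = (\<lambda>x. of_nat k * f x ^ (k - 1) * X f x)"
proof (induction k)
  case 0 then show ?case by (simp add: derivation_const)
next
  case (Suc k)
  then have "X (\<lambda>x. f x * f x ^ k) = (\<lambda>x. f x * X (\<lambda>x. f x ^ k) x + X f x * f x ^ k)"
    by (simp add: derivation_mult smooth_power)
  then show ?case
    using Suc by (cases k) (auto simp: fun_eq_iff algebra_simps)
qed

lemma derivation_poly_eval:
  assumes deg: "\<And>y. degree (P y) \<le> n"
    and smooth_coeff: "\<And>i. smooth (\<lambda>y. coeff (P y) i)"
    and X_coeff: "\<And>i. X (\<lambda>y. coeff (P y) i) = (\<lambda>y. 0)"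
    and F: "smooth F"
  shows "X (\<lambda>y. poly (P y) (F y)) = (\<lambda>y. poly (pderiv (P y)) (F y) * X F y)"
proof -
  have "X (\<lambda>y. poly (P y) (F y)) = X (\<lambda>y. \<Sum>i\<le>n. coeff (P y) i * F y ^ i)"
    by (simp add: poly_eq_sum_coeff_le[OF deg])
  also have "\<dots> = (\<lambda>y. \<Sum>i\<le>n. X (\<lambda>y. coeff (P y) i * F y ^ i) y)"
    by (rule derivation_sum) (simp_all add: smooth_mult smooth_power smooth_coeff F)
  also have "\<dots> = (\<lambda>y. \<Sum>i\<le>n. coeff (P y) i * (of_nat i * F y ^ (i - 1)) * X F y)"
    by (simp add: derivation_mult derivation_power smooth_coeff smooth_power F X_coeff mult.assoc)
  also have "\<dots> = (\<lambda>y. poly (pderiv (P y)) (F y) * X F y)"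
    by (simp add: poly_pderiv_eq_sum_coeff_le[OF deg] sum_distrib_right)
  finally show ?thesis .
qed

end

definition orbit_poly :: "('a \<Rightarrow> 'a) set \<Rightarrow> ('a \<Rightarrow> real) \<Rightarrow> 'a \<Rightarrow> real poly" where
  "orbit_poly S F y = (\<Prod>s\<in>S. [:- F (s y), 1:])"

lemma degree_orbit_poly: "finite S \<Longrightarrow> degree (orbit_poly S F y) \<le> card S"
  unfolding orbit_poly_def using degree_prod_sum_le[of S "\<lambda>s. [:- F (s y), 1:]"] by simp

lemma poly_orbit_poly_self: "finite S \<Longrightarrow> id \<in> S \<Longrightarrow> poly (orbit_poly S F y) (F y) = 0"
  unfolding orbit_poly_def poly_prod by (auto intro!: bexI[of _ id])

lemma poly_pderiv_orbit_poly_self: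
  assumes "finite S" "id \<in> S"
  shows "poly (pderiv (orbit_poly S F x)) (F x) = (\<Prod>s\<in>S - {id}. F x - F (s x))"
proof -
  define R where "R = (\<Prod>s\<in>S - {id}. [:- F (s x), 1:])"
  have factor: "orbit_poly S F x = [:- F x, 1:] * R"
    unfolding orbit_poly_def R_def prod.remove[OF assms] by simp
  have "poly (pderiv (orbit_poly S F x)) (F x) = poly R (F x)"
    unfolding factor pderiv_mult by (simp add: pderiv_pCons)
  then show ?thesis
    by (simp add: R_def poly_prod)
qed

lemma orbit_poly_compose_right:
  assumes "bij_betw (\<lambda>s. s \<circ> t) S S"
  shows "orbit_poly S F (t y) = orbit_poly S F y"
proof -
  have "orbit_poly S F (t y) = (\<Prod>s\<in>S. (\<lambda>r. [:- F (r y), 1:]) (s \<circ> t))"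
    unfolding orbit_poly_def by simp
  also have "\<dots> = orbit_poly S F y"
    unfolding orbit_poly_def by (rule prod.reindex_bij_betw[OF assms])
  finally show ?thesis .
qed

lemma smooth_coeff_orbit_poly:
  assumes "finite S" "\<And>s. s \<in> S \<Longrightarrow> bounded_linear s" "smooth F"
  shows "smooth (\<lambda>y. coeff (orbit_poly S F y) k)"
  unfolding orbit_poly_def
  by (rule smooth_coeff_prod_linear_factors) (use assms smooth_compose_bounded_linear in auto)

lemma interior_fixed_points_linear:
  fixes s :: "'a::euclidean_space \<Rightarrow> 'a"
  assumes "linear s" "s \<noteq> id"
  shows "interior {x. s x = x} = {}"
proof -
  have subspace: "subspace {x. s x = x}"
    unfolding subspace_def using assms(1) by (auto simp: linear_add linear_scale linear_0)
  have "dim {x. s x = x} < DIM('a)"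
  proof (rule ccontr)
    assume "\<not> ?thesis"
    then have "span {x. s x = x} = UNIV"
      using dim_subset_UNIV[of "{x. s x = x}"] by (simp add: dim_eq_full)
    then have "{x. s x = x} = UNIV" using subspace span_eq_iff by metis
    then show False using assms(2) by (auto simp: fun_eq_iff)
  qed
  then show ?thesis by (rule empty_interior_lowdim)
qed

lemma interior_finite_UN_closed_empty:
  assumes "finite T" "\<And>t. t \<in> T \<Longrightarrow> closed (K t)" "\<And>t. t \<in> T \<Longrightarrow> interior (K t) = {}"
  shows "interior (\<Union>t\<in>T. K t) = {}"
  using assms
proof (induction T rule: finite_induct)
  case (insert t T)
  have "interior ((\<Union>t\<in>T. K t) \<union> K t) = interior (\<Union>t\<in>T. K t)"
    using insert by (intro interior_closed_Un_empty_interior closed_UN) auto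
  then show ?case using insert by (simp add: Un_commute)
qed simp

lemma closure_non_fixed_points:
  fixes T :: "('a::euclidean_space \<Rightarrow> 'a) set"
  assumes "finite T" "\<And>s. s \<in> T \<Longrightarrow> linear s" "id \<notin> T"
  shows "closure {x. \<forall>s\<in>T. s x \<noteq> x} = UNIV"
proof -
  have "closed {x. s x = x}" if "s \<in> T" for s
    using assms(2)[OF that]
    by (intro closed_Collect_eq continuous_on_id linear_continuous_on)
       (simp add: linear_conv_bounded_linear)
  then have "interior (\<Union>s\<in>T. {x. s x = x}) = {}"
    using assms by (intro interior_finite_UN_closed_empty interior_fixed_points_linear) auto
  moreover have "{x. \<forall>s\<in>T. s x \<noteq> x} = - (\<Union>s\<in>T. {x. s x = x})"
    by auto
  ultimately show ?thesis
    by (simp only: closure_complement) simp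
qed

locale finite_linear_group =
  fixes S :: "('a::euclidean_space \<Rightarrow> 'a) set"
  assumes finite_S: "finite S"
    and id_in_S: "id \<in> S"
    and comp_in_S: "s \<in> S \<Longrightarrow> t \<in> S \<Longrightarrow> s \<circ> t \<in> S"
    and bounded_linear_elem: "s \<in> S \<Longrightarrow> bounded_linear s"
    and bij_elem: "s \<in> S \<Longrightarrow> bij s"
begin

lemma bij_betw_compose_right:
  assumes "t \<in> S"
  shows "bij_betw (\<lambda>s. s \<circ> t) S S"
proof -
  have "inj_on (\<lambda>s. s \<circ> t) S"
  proof (rule inj_onI)
    fix s s' assume "s \<circ> t = s' \<circ> t"
    then show "s = s'"
      using bij_is_surj[OF bij_elem[OF assms]] by (intro surj_fun_eq[of t UNIV]) auto
  qed
  moreover have "(\<lambda>s. s \<circ> t) ` S \<subseteq> S"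
    using assms comp_in_S by auto
  ultimately show ?thesis
    by (simp add: bij_betw_def endo_inj_surj finite_S)
qed

end

locale invariant_annihilating_derivation = finite_linear_group S for S +
  fixes X :: "('a::euclidean_space \<Rightarrow> real) \<Rightarrow> ('a \<Rightarrow> real)"
  assumes derivation: "smooth_derivation X"
    and annihilates_invariants:
      "\<And>f. smooth f \<Longrightarrow> (\<And>s v. s \<in> S \<Longrightarrow> f (s v) = f v) \<Longrightarrow> X f = (\<lambda>x. 0)"
begin

lemma vanishes_at_separating_point:
  assumes F: "smooth F" and separates: "\<And>s. s \<in> S \<Longrightarrow> s \<noteq> id \<Longrightarrow> F x \<noteq> F (s x)"
  shows "X F x = 0"
proof -
  let ?P = "orbit_poly S F"
  have smooth_coeff: "smooth (\<lambda>y. coeff (?P y) k)" for k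
    using smooth_coeff_orbit_poly[OF finite_S bounded_linear_elem F] by blast
  have "X (\<lambda>y. coeff (?P y) k) = (\<lambda>y. 0)" for k
  proof (rule annihilates_invariants[OF smooth_coeff])
    fix s v assume "s \<in> S"
    then show "coeff (?P (s v)) k = coeff (?P v) k"
      by (simp only: orbit_poly_compose_right[OF bij_betw_compose_right])
  qed
  with smooth_coeff F
  have chain: "X (\<lambda>y. poly (?P y) (F y)) = (\<lambda>y. poly (pderiv (?P y)) (F y) * X F y)"
    by (intro derivation_poly_eval[OF derivation degree_orbit_poly[OF finite_S]])
  have "X (\<lambda>y. poly (?P y) (F y)) = (\<lambda>y. 0)"
    using derivation_const[OF derivation] by (simp add: poly_orbit_poly_self finite_S id_in_S)
  then have "poly (pderiv (?P x)) (F x) * X F x = 0"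
    using fun_cong[OF trans[OF chain[symmetric]], of _ x] by simp
  moreover have "poly (pderiv (?P x)) (F x) \<noteq> 0"
    using separates by (simp add: poly_pderiv_orbit_poly_self finite_S id_in_S prod_zero_iff)
  ultimately show ?thesis
    by simp
qed

lemma vanishes_at_free_point:
  assumes f: "smooth f" and free: "\<And>s. s \<in> S \<Longrightarrow> s \<noteq> id \<Longrightarrow> s x \<noteq> x"
  shows "X f x = 0"
proof -
  define h where "h = (\<lambda>y. (norm (y - x))\<^sup>2)"
  have h: "smooth h"
    unfolding h_def by (rule smooth_norm_diff_power2)
  have h_x: "h x = 0"
    by (simp add: h_def)
  have h_separates: "h x \<noteq> h (s x)" if "s \<in> S" "s \<noteq> id" for s
    using free[OF that] by (simp add: h_def)
  \<comment> \<open>\<open>t\<close> avoids the values for which \<open>f + t h\<close> fails to separate \<open>x\<close> from \<open>s x\<close>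
    (the entry for \<open>s = id\<close> is the junk value of a division by \<open>h x = 0\<close>)\<close>
  have "finite ((\<lambda>s. (f x - f (s x)) / h (s x)) ` S)"
    using finite_S by simp
  then obtain t :: real where t: "t \<notin> (\<lambda>s. (f x - f (s x)) / h (s x)) ` S"
    using ex_new_if_finite[OF infinite_UNIV_char_0] by blast
  have smooth_th: "smooth (\<lambda>y. t * h y)"
    by (rule smooth_mult[OF smooth_const h])
  have "X (\<lambda>y. f y + t * h y) x = 0"
  proof (rule vanishes_at_separating_point)
    show "smooth (\<lambda>y. f y + t * h y)"
      by (rule smooth_add[OF f smooth_th])
    fix s assume s: "s \<in> S" "s \<noteq> id"
    have "h (s x) \<noteq> 0" and "t \<noteq> (f x - f (s x)) / h (s x)"
      using h_separates[OF s] h_x t s by auto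
    then show "f x + t * h x \<noteq> f (s x) + t * h (s x)"
      by (simp add: h_x field_simps)
  qed
  moreover have "X h x = 0"
    using h h_separates by (rule vanishes_at_separating_point)
  moreover have "X (\<lambda>y. f y + t * h y) = (\<lambda>y. X f y + t * X h y)"
    by (simp only: derivation_add[OF derivation f smooth_th] derivation_scale[OF derivation h])
  ultimately show ?thesis
    by simp
qed

theorem vanishes:
  assumes f: "smooth f"
  shows "X f = (\<lambda>x. 0)"
proof
  fix x
  let ?free = "{y. \<forall>s\<in>S - {id}. s y \<noteq> y}"
  have dense: "closure ?free = UNIV"
    using finite_S bounded_linear_elem
    by (intro closure_non_fixed_points) (simp_all add: bounded_linear.linear)
  have "continuous_on UNIV (X f)"
    by (rule smooth_imp_continuous_on[OF derivation_smooth[OF derivation f]])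
  then show "X f x = 0"
  proof (rule continuous_constant_on_closure[OF continuous_on_subset])
    show "X f y = 0" if "y \<in> ?free" for y
      using that by (intro vanishes_at_free_point[OF f]) simp
  qed (simp_all add: dense)
qed

end

lemma unitary_map_bounded_linear:
  fixes U :: "complex^'n \<Rightarrow> complex^'n"
  assumes "unitary_map U"
  shows "bounded_linear U"
proof -
  have "Vector_Spaces.linear (*s) (*s) U"
    using assms by (simp add: unitary_map_def)
  then have add: "U (a + b) = U a + U b" and scale: "U (c *s a) = c *s U a" for a b c
    by (auto simp: Vector_Spaces.linear_def module_hom_def module_hom_axioms_def)
  have "r *\<^sub>R a = complex_of_real r *s a" for r and a :: "complex^'n"
    by (simp add: vec_eq_iff) (simp add: scaleR_conv_of_real)
  then have "U (r *\<^sub>R a) = r *\<^sub>R U a" for r a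
    by (simp add: scale)
  then have "linear U"
    using add by (simp add: linear_iff)
  then show ?thesis
    by (simp add: linear_conv_bounded_linear)
qed

lemma finite_linear_group_image:
  fixes \<rho> :: "'g \<Rightarrow> 'a::euclidean_space \<Rightarrow> 'a"
  assumes G: "group G" "finite (carrier G)"
    and elem: "\<And>g. g \<in> carrier G \<Longrightarrow> bounded_linear (\<rho> g) \<and> bij (\<rho> g)"
    and hom: "\<And>g h. g \<in> carrier G \<Longrightarrow> h \<in> carrier G \<Longrightarrow> \<rho> (g \<otimes>\<^bsub>G\<^esub> h) = \<rho> g \<circ> \<rho> h"
  shows "finite_linear_group (\<rho> ` carrier G)"
proof (rule finite_linear_group.intro)
  interpret group G by (rule G(1))
  show "finite (\<rho> ` carrier G)"
    using G(2) by simp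
  have inj: "inj (\<rho> \<one>\<^bsub>G\<^esub>)"
    using elem[OF one_closed] bij_is_inj by blast
  have "\<rho> \<one>\<^bsub>G\<^esub> \<circ> \<rho> \<one>\<^bsub>G\<^esub> = \<rho> (\<one>\<^bsub>G\<^esub> \<otimes>\<^bsub>G\<^esub> \<one>\<^bsub>G\<^esub>)"
    by (rule hom[symmetric]) (rule one_closed)+
  also have "\<dots> = \<rho> \<one>\<^bsub>G\<^esub>"
    by simp
  finally have idem: "\<rho> \<one>\<^bsub>G\<^esub> \<circ> \<rho> \<one>\<^bsub>G\<^esub> = \<rho> \<one>\<^bsub>G\<^esub>" .
  have one_id: "\<rho> \<one>\<^bsub>G\<^esub> = id"
  proof
    show "\<rho> \<one>\<^bsub>G\<^esub> v = id v" for v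
      using injD[OF inj fun_cong[OF idem, of v, unfolded comp_apply]] by (simp only: id_apply)
  qed
  show "id \<in> \<rho> ` carrier G"
    using rev_image_eqI[of _ _ _ \<rho>, OF one_closed one_id[symmetric]] .
  show "s \<circ> t \<in> \<rho> ` carrier G" if s_in: "s \<in> \<rho> ` carrier G" and t_in: "t \<in> \<rho> ` carrier G" for s t
  proof -
    obtain g where s: "s = \<rho> g" and g: "g \<in> carrier G"
      using s_in by (rule imageE)
    obtain h where t: "t = \<rho> h" and h: "h \<in> carrier G"
      using t_in by (rule imageE)
    have "s \<circ> t = \<rho> (g \<otimes>\<^bsub>G\<^esub> h)"
      by (simp only: s t hom[OF g h])
    then show ?thesis
      by (rule rev_image_eqI[of _ _ _ \<rho>, OF m_closed[OF g h]])
  qed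
  show "bounded_linear s" if "s \<in> \<rho> ` carrier G" for s
    using that elem by blast
  show "bij s" if "s \<in> \<rho> ` carrier G" for s
    using that elem by blast
qed

theorem mainTheorem10:
  fixes G :: "('g, 'b) monoid_scheme"
    and \<rho> :: "'g \<Rightarrow> complex^'n \<Rightarrow> complex^'n"
    and X :: "(complex^'n \<Rightarrow> real) \<Rightarrow> (complex^'n \<Rightarrow> real)"
  assumes "group G"
    and "finite (carrier G)"
    and "\<forall>g\<in>carrier G. unitary_map (\<rho> g)"
    and "\<forall>g\<in>carrier G. \<forall>h\<in>carrier G. \<rho> (g \<otimes>\<^bsub>G\<^esub> h) = \<rho> g \<circ> \<rho> h"
    and "smooth_derivation X"
    and "\<forall>f. smooth f \<and> (\<forall>g\<in>carrier G. \<forall>v. f (\<rho> g v) = f v) \<longrightarrow> X f = (\<lambda>x. 0)"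
  shows "\<forall>f. smooth f \<longrightarrow> X f = (\<lambda>x. 0)"
proof -
  have "bounded_linear (\<rho> g) \<and> bij (\<rho> g)" if "g \<in> carrier G" for g
    using assms(3) that unitary_map_bounded_linear unfolding unitary_map_def by blast
  then have "finite_linear_group (\<rho> ` carrier G)"
    using assms(1,2,4) by (intro finite_linear_group_image) auto
  then interpret invariant_annihilating_derivation "\<rho> ` carrier G" X
  proof (rule invariant_annihilating_derivation.intro, unfold_locales)
    show "smooth_derivation X"
      by (rule assms(5))
    show "X f = (\<lambda>x. 0)" if "smooth f" "\<And>s v. s \<in> \<rho> ` carrier G \<Longrightarrow> f (s v) = f v" for f
      using assms(6) that by blast
  qed
  show ?thesis
    using vanishes by blast
qed

end
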